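(* Let $r\geq 2$, $1\leq \ell\leq r$, and for $n\geq\binom{r}{\ell}$ let $(V_1^{(n)},\ldots,V_r^{(n)})$ be uniformly distributed on $H_{\ell,r}(n)$. Let $f:\mathbb{N}\to\mathbb{C}$ be an arbitrary arithmetic function. Then \[ f({\rm GCD}(V_1^{(n)},\ldots,V_r^{(n)}))\overset{{\rm d}}{\underset{n\to\infty}\longrightarrow} f\Big(\prod_{p\in\mathcal{P}}p^{\min_{k=1,\ldots,r}\mathcal{G}_k(p)}\Big). \]
   Context: $P_\ell(x_1,\ldots,x_r)=\sum_{1\leq i_1<\cdots<i_\ell\leq r}x_{i_1}\cdots x_{i_\ell}$; $H_{\ell,r}(n)=\{(i_1,\ldots,i_r)\in\mathbb{N}^r: P_\ell(i_1,\ldots,i_r)\leq n\}$, $\mathbb{N}=\{1,2,\ldots\}$. $\mathcal{P}$ is the set of primes, and $(\mathcal{G}_k(p))_{k\in\mathbb{N},p\in\mathcal{P}}$ are mutually independent random variables with $\mathbb{P}\{\mathcal{G}_k(p)=j\}=(1-1/p)p^{-j}$, $j=0,1,2,\ldots$ (the infinite product in the limit converges almost surely). *)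

theory Defs
  imports "HOL-Probability.Probability"
begin

definition esym :: "nat \<Rightarrow> nat \<Rightarrow> (nat \<Rightarrow> nat) \<Rightarrow> nat" where
  "esym l r x = (\<Sum>I | I \<subseteq> {1..r} \<and> card I = l. \<Prod>i\<in>I. x i)"

definition hyperbolic_region :: "nat \<Rightarrow> nat \<Rightarrow> nat \<Rightarrow> (nat \<Rightarrow> nat) set" where
  "hyperbolic_region l r n = {x \<in> {1..r} \<rightarrow>\<^sub>E {1..}. esym l r x \<le> n}"

text \<open>
  The library's \<^const>\<open>weak_conv_m\<close> only covers real-valued variables. The variables may live on
  different probability spaces, and only the tail of the sequence matters, so measurability
  is required eventually; without it the Bochner integrals would silently be 0.
\<close>

definition converges_in_distribution ::
  "(nat \<Rightarrow> 'a measure) \<Rightarrow> (nat \<Rightarrow> 'a \<Rightarrow> 'c::metric_space) \<Rightarrow> 'b measure \<Rightarrow> ('b \<Rightarrow> 'c) \<Rightarrow> bool" where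
  "converges_in_distribution N X M Y \<longleftrightarrow>
     (\<forall>\<^sub>F n in sequentially. X n \<in> borel_measurable (N n)) \<and>
     Y \<in> borel_measurable M \<and>
     (\<forall>g :: 'c \<Rightarrow> real. continuous_on UNIV g \<and> bounded (range g) \<longrightarrow>
        (\<lambda>n. \<integral>\<omega>. g (X n \<omega>) \<partial>N n) \<longlonglongrightarrow> (\<integral>\<omega>. g (Y \<omega>) \<partial>M))"

end

theory Submission
  imports Defs
begin

text \<open>
  Convergence of the gcd is reduced to convergence of the probabilities that a fixed \<open>d\<close> divides it:
  if \<open>P(d | X\<^sub>n) \<rightarrow> P(d | Y)\<close> for every \<open>d\<close>, with \<open>P(d | X\<^sub>n) \<le> d\<^bsup>-r\<^esup>\<close> summable, then the laws of
  \<open>gcd(X\<^sub>n, K!)\<close> converge for each \<open>K\<close> and approximate those of \<open>X\<^sub>n\<close> uniformly in \<open>n\<close>. For the limit,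
  independence gives \<open>P(d | Y) = d\<^bsup>-r\<^esup>\<close>.

  For the region \<open>H\<close>, rounding all coordinates to multiples of \<open>d\<close> shows that the proportion of
  points divisible by \<open>d\<close> is \<open>d\<^bsup>-r\<^esup>\<close> up to the proportion of points with a coordinate below \<open>d\<close>, so it
  suffices that the slice \<open>x\<^sub>i = 1\<close> is negligible. No asymptotics of \<open>|H|\<close> are needed: up to a bounded
  number of points, the slice \<open>x\<^sub>i = c\<close> has at least \<open>1/(rc)\<close> times as many points as the slice
  \<open>x\<^sub>i = 1\<close>, and the harmonic series diverges.
\<close>

subsection \<open>Lattice points of the hyperbolic region\<close>

lemma finite_esym_index: "finite {I. I \<subseteq> {1..r::nat} \<and> card I = l}"
  by (rule finite_subset[of _ "Pow {1..r}"]) auto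

lemma esym_mono:
  assumes "\<And>i. i \<in> {1..r} \<Longrightarrow> x i \<le> y i"
  shows "esym l r x \<le> esym l r y"
  unfolding esym_def using assms by (intro sum_mono prod_mono) auto

text \<open>Index sets are sorted by whether they contain neither, exactly one, or both of
  \<open>i\<close> and \<open>j\<close>. With the other coordinates fixed, \<open>esym\<close> is
  thus monotone in the sum and the product of these two. For \<open>l = 0\<close> the truncated
  \<open>l - 1\<close> would let the empty set enter the middle sum, whence
  \<open>1 \<le> l\<close>.\<close>

lemma esym_two_coordinates:
  assumes ij: "i \<in> {1..r}" "j \<in> {1..r}" "i \<noteq> j" and l: "1 \<le> l"
  shows "esym l r x =
           (\<Sum>I | I \<subseteq> {1..r} - {i, j} \<and> card I = l. \<Prod>k\<in>I. x k) +
           (x i + x j) * (\<Sum>I | I \<subseteq> {1..r} - {i, j} \<and> card I = l - 1. \<Prod>k\<in>I. x k) +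
           x i * x j * (\<Sum>I | I \<subseteq> {1..r} \<and> card I = l \<and> i \<in> I \<and> j \<in> I. \<Prod>k\<in>I - {i, j}. x k)"
proof -
  define F where "F = {I. I \<subseteq> {1..r} \<and> card I = l}"
  have finF: "finite F"
    unfolding F_def by (rule finite_esym_index)
  \<comment> \<open>Deleting \<open>a\<close> is a bijection onto the \<open>(l - 1)\<close>-sets
    avoiding \<open>a\<close> and \<open>b\<close>; it serves for both \<open>(i, j)\<close> and
    \<open>(j, i)\<close>.\<close>
  have single: "(\<Sum>I | I \<in> F \<and> a \<in> I \<and> b \<notin> I. \<Prod>k\<in>I. x k) =
      x a * (\<Sum>I | I \<subseteq> {1..r} - {a, b} \<and> card I = l - 1. \<Prod>k\<in>I. x k)"
    if ab: "a \<in> {1..r}" "b \<in> {1..r}" "a \<noteq> b" for a b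
  proof -
    have "(\<Sum>I | I \<in> F \<and> a \<in> I \<and> b \<notin> I. \<Prod>k\<in>I. x k) =
        (\<Sum>I | I \<subseteq> {1..r} - {a, b} \<and> card I = l - 1. x a * (\<Prod>k\<in>I. x k))"
    proof (rule sum.reindex_bij_witness[of _ "insert a" "\<lambda>I. I - {a}"])
      fix I assume "I \<in> {I. I \<in> F \<and> a \<in> I \<and> b \<notin> I}"
      then have I: "I \<subseteq> {1..r}" "card I = l" "a \<in> I" "b \<notin> I"
        by (auto simp: F_def)
      then have fin: "finite I" by (auto intro: finite_subset)
      show "insert a (I - {a}) = I" using I by auto
      show "I - {a} \<in> {I. I \<subseteq> {1..r} - {a, b} \<and> card I = l - 1}"
        using I fin by auto
      show "x a * (\<Prod>k\<in>I - {a}. x k) = (\<Prod>k\<in>I. x k)"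
        using I fin by (simp add: prod.remove)
    next
      fix I assume "I \<in> {I. I \<subseteq> {1..r} - {a, b} \<and> card I = l - 1}"
      then have I: "I \<subseteq> {1..r}" "card I = l - 1" "a \<notin> I" "b \<notin> I" by auto
      then have fin: "finite I" by (auto intro: finite_subset)
      show "insert a I - {a} = I" using I by auto
      show "insert a I \<in> {I. I \<in> F \<and> a \<in> I \<and> b \<notin> I}"
        using I fin ab l by (auto simp: F_def)
    qed
    then show ?thesis by (simp add: sum_distrib_left)
  qed
  have both: "(\<Sum>I | I \<in> F \<and> i \<in> I \<and> j \<in> I. \<Prod>k\<in>I. x k) =
      x i * x j * (\<Sum>I | I \<subseteq> {1..r} \<and> card I = l \<and> i \<in> I \<and> j \<in> I. \<Prod>k\<in>I - {i, j}. x k)"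
    unfolding sum_distrib_left
  proof (rule sum.cong)
    fix I assume "I \<in> {I. I \<subseteq> {1..r} \<and> card I = l \<and> i \<in> I \<and> j \<in> I}"
    then have I: "i \<in> I" "j \<in> I" "finite I" by (auto intro: finite_subset)
    have "(\<Prod>k\<in>I. x k) = (\<Prod>k\<in>{i, j}. x k) * (\<Prod>k\<in>I - {i, j}. x k)"
      using I by (subst prod.subset_diff[of "{i, j}"]) (auto simp: mult.commute)
    then show "(\<Prod>k\<in>I. x k) = x i * x j * (\<Prod>k\<in>I - {i, j}. x k)"
      using ij by simp
  qed (auto simp: F_def)
  have none: "{I. I \<in> F \<and> i \<notin> I \<and> j \<notin> I} = {I. I \<subseteq> {1..r} - {i, j} \<and> card I = l}"
    by (auto simp: F_def)
  have split: "F = {I. I \<in> F \<and> i \<notin> I \<and> j \<notin> I} \<union> {I. I \<in> F \<and> i \<in> I \<and> j \<notin> I} \<union>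
      {I. I \<in> F \<and> j \<in> I \<and> i \<notin> I} \<union> {I. I \<in> F \<and> i \<in> I \<and> j \<in> I}"
    by blast
  have "esym l r x = (\<Sum>I\<in>F. \<Prod>k\<in>I. x k)"
    by (simp add: esym_def F_def)
  also have "\<dots> = (\<Sum>I | I \<in> F \<and> i \<notin> I \<and> j \<notin> I. \<Prod>k\<in>I. x k) +
      (\<Sum>I | I \<in> F \<and> i \<in> I \<and> j \<notin> I. \<Prod>k\<in>I. x k) +
      (\<Sum>I | I \<in> F \<and> j \<in> I \<and> i \<notin> I. \<Prod>k\<in>I. x k) +
      (\<Sum>I | I \<in> F \<and> i \<in> I \<and> j \<in> I. \<Prod>k\<in>I. x k)"
    using finF by (subst split, (subst sum.union_disjoint; auto?)+)
  finally show ?thesis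
    using single[of i j] single[of j i] ij none both
    by (simp add: insert_commute algebra_simps)
qed

text \<open>The three coefficient sums do not involve the coordinates \<open>i\<close> and
  \<open>j\<close>, so they agree for \<open>x\<close> and \<open>y\<close>; being natural numbers,
  they preserve the two inequalities.\<close>

lemma esym_decreasing_two_coordinates:
  assumes ij: "i \<in> {1..r}" "j \<in> {1..r}" "i \<noteq> j" and l: "1 \<le> l"
    and eq: "\<And>k. k \<noteq> i \<Longrightarrow> k \<noteq> j \<Longrightarrow> y k = x k"
    and "y i + y j \<le> x i + x j" and "y i * y j \<le> x i * x j"
  shows "esym l r y \<le> esym l r x"
proof -
  have "(\<Prod>k\<in>I. y k) = (\<Prod>k\<in>I. x k)" if "i \<notin> I" "j \<notin> I" for I
    using that by (intro prod.cong eq) auto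
  \<comment> \<open>\<open>h\<close> is the identity in the first two sums and removes
    \<open>{i, j}\<close> in the third.\<close>
  then have c: "(\<Sum>I\<in>F. \<Prod>k\<in>h I. y k) = (\<Sum>I\<in>F. \<Prod>k\<in>h I. x k)"
    if "\<And>I. I \<in> F \<Longrightarrow> i \<notin> h I \<and> j \<notin> h I" for F :: "nat set set" and h
    using that by (intro sum.cong) auto
  show ?thesis
    unfolding esym_two_coordinates[OF ij l]
    by (subst (1 2 3) c) (use assms in \<open>auto intro!: add_mono mult_mono\<close>)
qed

text \<open>Some monomial contains \<open>x i\<close>, and its other factors are at least 1. On the
  region this bounds every coordinate by \<open>n\<close>.\<close>

lemma le_esym:
  assumes "1 \<le> l" "l \<le> r" "i \<in> {1..r}" and pos: "\<And>k. k \<in> {1..r} \<Longrightarrow> 1 \<le> x k"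
  shows "x i \<le> esym l r x"
proof -
  have "l - 1 \<le> card ({1..r} - {i})" using assms by simp
  then obtain J where J: "J \<subseteq> {1..r} - {i}" "card J = l - 1" "finite J"
    by (rule obtain_subset_with_card_n)
  define I where "I = insert i J"
  have I: "I \<subseteq> {1..r}" "card I = l" "i \<in> I" "finite I"
    using J assms by (auto simp: I_def card_insert_if)
  have "1 \<le> (\<Prod>k\<in>I - {i}. x k)"
    using I pos by (intro prod_ge_1) auto
  then have "x i \<le> (\<Prod>k\<in>I. x k)"
    using I by (simp add: prod.remove[of I i])
  also have "\<dots> \<le> esym l r x"
    unfolding esym_def using I by (intro member_le_sum) (auto intro: finite_esym_index[simplified])
  finally show ?thesis .
qed

section \<open>Finiteness and growth of the region\<close>

lemma finite_hyperbolic_region: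
  assumes "1 \<le> l" "l \<le> r"
  shows "finite (hyperbolic_region l r n)"
proof (rule finite_subset)
  show "hyperbolic_region l r n \<subseteq> {1..r} \<rightarrow>\<^sub>E {..n}"
  proof
    fix x assume x: "x \<in> hyperbolic_region l r n"
    then have "x k \<le> n" if "k \<in> {1..r}" for k
      using le_esym[OF assms that, of x] by (auto simp: hyperbolic_region_def PiE_def Pi_def)
    with x show "x \<in> {1..r} \<rightarrow>\<^sub>E {..n}"
      by (auto simp: hyperbolic_region_def PiE_def Pi_def)
  qed
qed (auto intro: finite_PiE)

lemma hyperbolic_region_downward_closed:
  assumes "x \<in> hyperbolic_region l r n" "y \<in> {1..r} \<rightarrow>\<^sub>E {1..}"
    and "\<And>k. k \<in> {1..r} \<Longrightarrow> y k \<le> x k"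
  shows "y \<in> hyperbolic_region l r n"
  using assms esym_mono[of r y x l] by (auto simp: hyperbolic_region_def)

text \<open>At a point \<open>(m, 1, ..., 1)\<close> each of the \<open>r choose l\<close> monomials
  is at most \<open>m\<close>. This crude bound serves only to let the size of the region tend to
  infinity.\<close>

lemma card_hyperbolic_region_ge:
  assumes "1 \<le> l" "l \<le> r"
  shows "n div (r choose l) \<le> card (hyperbolic_region l r n)"
proof -
  define g where "g m = (\<lambda>k\<in>{1..r}. if k = 1 then m else 1::nat)" for m :: nat
  have "card {1..n div (r choose l)} \<le> card (hyperbolic_region l r n)"
  proof (rule card_inj_on_le[of g])
    show "inj_on g {1..n div (r choose l)}"
    proof (rule inj_onI)
      fix m m' assume "g m = g m'"
      then have "g m 1 = g m' 1" by simp
      then show "m = m'" using assms by (simp add: g_def)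
    qed
    show "g ` {1..n div (r choose l)} \<subseteq> hyperbolic_region l r n"
    proof
      fix x assume "x \<in> g ` {1..n div (r choose l)}"
      then obtain m where m: "1 \<le> m" "m \<le> n div (r choose l)" "x = g m" by auto
      have "(\<Prod>i\<in>I. x i) \<le> m" if I: "I \<subseteq> {1..r}" for I
      proof -
        have fin: "finite I" using I by (auto intro: finite_subset)
        have "(\<Prod>i\<in>I. x i) = (\<Prod>i\<in>I. if i = 1 then m else 1)"
          using I by (intro prod.cong) (auto simp: m g_def)
        also have "\<dots> \<le> m" using fin m by (simp add: prod.delta)
        finally show ?thesis .
      qed
      then have "esym l r x \<le> (\<Sum>I | I \<subseteq> {1..r} \<and> card I = l. m)"
        unfolding esym_def by (intro sum_mono) auto
      also have "\<dots> = (r choose l) * m"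
        using n_subsets[of "{1..r}" l] by simp
      also have "\<dots> \<le> (r choose l) * (n div (r choose l))"
        using m by simp
      also have "\<dots> \<le> n" by simp
      finally show "x \<in> hyperbolic_region l r n"
        using m by (auto simp: hyperbolic_region_def g_def)
    qed
  qed (rule finite_hyperbolic_region[OF assms])
  then show ?thesis by simp
qed

lemma filterlim_card_hyperbolic_region:
  assumes "1 \<le> l" "l \<le> r"
  shows "filterlim (\<lambda>n. real (card (hyperbolic_region l r n))) at_top sequentially"
  unfolding filterlim_at_top
proof
  fix Z :: real
  define m where "m = nat \<lceil>Z\<rceil>"
  have c: "r choose l > 0" using assms by simp
  show "\<forall>\<^sub>F n in sequentially. Z \<le> real (card (hyperbolic_region l r n))"
  proof (rule eventually_sequentiallyI)
    fix n assume "m * (r choose l) \<le> n"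
    then have "m \<le> n div (r choose l)"
      using c by (metis div_le_mono nonzero_mult_div_cancel_right less_numeral_extra(3))
    also note card_hyperbolic_region_ge[OF assms]
    finally show "Z \<le> real (card (hyperbolic_region l r n))"
      unfolding m_def by linarith
  qed
qed

section \<open>Negligibility of the slices with a coordinate equal to 1\<close>

text \<open>With \<open>q = a div c \<ge> 1\<close>, expanding
  \<open>(c - 1) * (q - 1) \<ge> 0\<close> gives \<open>c + q \<le> 1 + c * q\<close>, and
  \<open>c * q \<le> a\<close>. This is the sum condition for the exchange of two coordinates
  below.\<close>

lemma sum_div_le:
  fixes a c :: nat
  assumes "1 \<le> c" "c \<le> a"
  shows "c + a div c \<le> 1 + a"
proof -
  define q where "q = a div c"
  have q: "1 \<le> q"
    using assms unfolding q_def by (metis div_le_mono div_self not_one_le_zero)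
  have "c * q \<le> a" by (simp add: q_def)
  moreover have "c + q \<le> 1 + c * q"
  proof -
    obtain c' q' where "c = Suc c'" "q = Suc q'" using assms q by (metis Suc_le_D One_nat_def)
    then show ?thesis by simp
  qed
  ultimately show ?thesis unfolding q_def by linarith
qed

text \<open>
  Trading a coordinate \<open>x\<^sub>j \<ge> c\<close> for \<open>x\<^sub>j div c\<close> while raising \<open>x\<^sub>i\<close> from \<open>1\<close> to \<open>c\<close> increases neither
  the sum nor the product of the two coordinates, hence does not leave the region.
\<close>
lemma card_slice_one_le:
  assumes l: "1 \<le> l" "l \<le> r" and i: "i \<in> {1..r}" and c: "1 \<le> c"
  shows "card {x \<in> hyperbolic_region l r n. x i = 1}
           \<le> (c + 1) ^ r + r * c * card {x \<in> hyperbolic_region l r n. x i = c}"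
proof -
  let ?H = "hyperbolic_region l r n"
  define S where "S = {x \<in> ?H. x i = c}"
  define B where "B j = {x \<in> ?H. x i = 1 \<and> c \<le> x j}" for j
  have finH: "finite ?H" by (rule finite_hyperbolic_region[OF l])
  have B: "card (B j) \<le> c * card S" if j: "j \<in> {1..r} - {i}" for j
  proof -
    \<comment> \<open>The remainder is what the division loses; recording it makes the map injective
      at the price of a factor \<open>c\<close>.\<close>
    define g where "g x = (x j mod c, x(i := c, j := x j div c))" for x :: "nat \<Rightarrow> nat"
    have "card (B j) \<le> card ({..<c} \<times> S)"
    proof (rule card_inj_on_le[of g])
      show "inj_on g (B j)"
      proof (rule inj_onI)
        fix x y assume xy: "x \<in> B j" "y \<in> B j" "g x = g y"
        then have "x j mod c = y j mod c" and e: "x(i := c, j := x j div c) = y(i := c, j := y j div c)"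
          by (auto simp: g_def)
        moreover have "x j div c = y j div c" using fun_cong[OF e, of j] by simp
        ultimately have "x j = y j" by (metis div_mod_decomp)
        moreover have "x k = y k" if "k \<noteq> i" "k \<noteq> j" for k
          using fun_cong[OF e, of k] that by simp
        moreover have "x i = y i" using xy by (simp add: B_def)
        ultimately show "x = y" by (intro ext) metis
      qed
      show "g ` B j \<subseteq> {..<c} \<times> S"
      proof
        fix z assume "z \<in> g ` B j"
        then obtain x where x: "x \<in> ?H" "x i = 1" "c \<le> x j" "z = g x"
          by (auto simp: B_def)
        define y where "y = x(i := c, j := x j div c)"
        have "esym l r y \<le> esym l r x"
        proof (rule esym_decreasing_two_coordinates[of i r j])
          show "y i + y j \<le> x i + x j"
            using sum_div_le[of c "x j"] c x j by (simp add: y_def)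
          show "y i * y j \<le> x i * x j"
            using x j by (simp add: y_def)
        qed (use i j l in \<open>auto simp: y_def\<close>)
        moreover have "1 \<le> x j div c"
          using x c by (metis div_le_mono div_self le_zero_eq not_one_le_zero)
        ultimately have "y \<in> ?H"
          using x i j c unfolding hyperbolic_region_def y_def
          by (auto simp: PiE_def Pi_def extensional_def)
        then show "z \<in> {..<c} \<times> S"
          using x c j by (auto simp: g_def S_def y_def)
      qed
    qed (use finH in \<open>auto simp: S_def\<close>)
    then show ?thesis by (simp add: card_cartesian_product)
  qed
  \<comment> \<open>If no other coordinate reaches \<open>c\<close>, then all are at most
    \<open>c\<close>, since \<open>x i = 1 \<le> c\<close>. Such points lie in a box of
    \<open>(c + 1) ^ r\<close> points, whatever \<open>n\<close> is.\<close>
  have "{x \<in> ?H. x i = 1} \<subseteq> ({1..r} \<rightarrow>\<^sub>E {..c}) \<union> (\<Union>j\<in>{1..r} - {i}. B j)"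
  proof
    fix x assume x: "x \<in> {x \<in> ?H. x i = 1}"
    show "x \<in> ({1..r} \<rightarrow>\<^sub>E {..c}) \<union> (\<Union>j\<in>{1..r} - {i}. B j)"
    proof (cases "\<exists>j\<in>{1..r} - {i}. c \<le> x j")
      case True
      then show ?thesis using x by (auto simp: B_def)
    next
      case False
      then have "x k \<le> c" if "k \<in> {1..r}" for k
        using x c that by (cases "k = i") force+
      then show ?thesis using x by (auto simp: hyperbolic_region_def PiE_def Pi_def)
    qed
  qed
  then have "card {x \<in> ?H. x i = 1} \<le> card (({1..r} \<rightarrow>\<^sub>E {..c}) \<union> (\<Union>j\<in>{1..r} - {i}. B j))"
    using finH by (intro card_mono) (auto simp: B_def intro!: finite_PiE)
  also have "\<dots> \<le> card ({1..r} \<rightarrow>\<^sub>E {..c}) + card (\<Union>j\<in>{1..r} - {i}. B j)"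
    by (rule card_Un_le)
  also have "card ({1..r} \<rightarrow>\<^sub>E {..c}) = (c + 1) ^ r"
    by (simp add: card_PiE)
  also have "card (\<Union>j\<in>{1..r} - {i}. B j) \<le> (\<Sum>j\<in>{1..r} - {i}. card (B j))"
    by (rule card_UN_le) simp
  also have "\<dots> \<le> (\<Sum>j\<in>{1..r} - {i}. c * card S)"
    by (intro sum_mono B)
  also have "\<dots> \<le> r * c * card S"
    using i by simp
  finally show ?thesis by (simp add: S_def)
qed

text \<open>The slices \<open>x i = c\<close> for \<open>c = 1, ..., K\<close> are disjoint, so
  their sizes add up to at most that of the region. By \<open>card_slice_one_le\<close> the
  proportion of the slice at 1 is then at most about \<open>r / harm K\<close>.\<close>

lemma slice_one_negligible:
  assumes l: "1 \<le> l" "l \<le> r" and i: "i \<in> {1..r}"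
  shows "(\<lambda>n. real (card {x \<in> hyperbolic_region l r n. x i = 1}) /
                real (card (hyperbolic_region l r n))) \<longlonglongrightarrow> 0"
proof (rule LIMSEQ_I)
  fix e :: real assume e: "e > 0"
  let ?H = "hyperbolic_region l r"
  define N where "N c n = real (card {x \<in> ?H n. x i = c})" for c n
  have r: "r > 0" using l by simp
  \<comment> \<open>The factor 2 leaves room for the error \<open>C\<close> below, which is less
    than the size of the region for large \<open>n\<close>.\<close>
  have "\<forall>\<^sub>F K in sequentially. 2 * r / e < (harm K :: real)"
    using harm_at_top by (simp add: filterlim_at_top_dense)
  then obtain K where K: "2 * r / e < (harm K :: real)"
    by (auto simp: eventually_sequentially)
  \<comment> \<open>Total of the box terms after division by \<open>r * c\<close>; it depends on
    \<open>K\<close> but not on \<open>n\<close>.\<close>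
  define C where "C = (\<Sum>c=1..K. real ((c + 1) ^ r) / (r * c))"
  have main: "N 1 n * harm K \<le> r * (real (card (?H n)) + C)" for n
  proof -
    have "N 1 n / (r * c) - real ((c + 1) ^ r) / (r * c) \<le> N c n" if "c \<in> {1..K}" for c
    proof -
      have "N 1 n \<le> real ((c + 1) ^ r + r * c * card {x \<in> ?H n. x i = c})"
        unfolding N_def using that by (intro of_nat_mono card_slice_one_le[OF l i]) auto
      then have "N 1 n - real ((c + 1) ^ r) \<le> N c n * (r * c)"
        by (simp add: N_def mult_ac)
      then have "(N 1 n - real ((c + 1) ^ r)) / (r * c) \<le> N c n"
        using that r by (subst pos_divide_le_eq) auto
      then show ?thesis by (simp add: diff_divide_distrib)
    qed
    then have "(\<Sum>c=1..K. N 1 n / (r * c) - real ((c + 1) ^ r) / (r * c)) \<le> (\<Sum>c=1..K. N c n)"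
      by (rule sum_mono)
    also have "\<dots> = real (card (\<Union>c\<in>{1..K}. {x \<in> ?H n. x i = c}))"
    proof -
      have "card (\<Union>c\<in>{1..K}. {x \<in> ?H n. x i = c}) = (\<Sum>c\<in>{1..K}. card {x \<in> ?H n. x i = c})"
        using finite_hyperbolic_region[OF l, of n] by (intro card_UN_disjoint) auto
      then show ?thesis by (simp add: N_def)
    qed
    also have "\<dots> \<le> real (card (?H n))"
      by (intro of_nat_mono card_mono finite_hyperbolic_region[OF l]) auto
    finally have "(\<Sum>c=1..K. N 1 n / (r * c)) \<le> real (card (?H n)) + C"
      by (simp add: sum_subtractf C_def)
    moreover have "(\<Sum>c=1..K. N 1 n / (r * c)) = N 1 n * harm K / r"
      by (simp add: harm_def sum_distrib_left sum_divide_distrib field_simps)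
    ultimately have "N 1 n * harm K / r \<le> real (card (?H n)) + C" by simp
    then show ?thesis using r by (simp add: field_simps)
  qed
  have "\<forall>\<^sub>F n in sequentially. real (card (?H n)) > max 0 C"
    using filterlim_card_hyperbolic_region[OF l] unfolding filterlim_at_top_dense by blast
  then obtain n0 where n0: "\<And>n. n \<ge> n0 \<Longrightarrow> real (card (?H n)) > max 0 C"
    by (auto simp: eventually_sequentially)
  show "\<exists>no. \<forall>n\<ge>no. norm (N 1 n / real (card (?H n)) - 0) < e"
  proof (intro exI allI impI)
    fix n assume "n \<ge> n0"
    then have H: "real (card (?H n)) > 0" "C < real (card (?H n))" using n0[of n] by auto
    have hK: "harm K > (0::real)" using K e r by (smt (verit) divide_nonneg_pos of_nat_0_le_iff)
    have "r * (real (card (?H n)) + C) \<le> 2 * r * real (card (?H n))"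
      using H r by (simp add: algebra_simps)
    with main[of n] have "N 1 n * harm K \<le> 2 * r * real (card (?H n))" by linarith
    also have "\<dots> < e * harm K * real (card (?H n))"
      using K e H by (simp add: field_simps)
    finally have "N 1 n < e * real (card (?H n))" using hK by (simp add: mult_ac)
    moreover have "N 1 n \<ge> 0" by (simp add: N_def)
    ultimately show "norm (N 1 n / real (card (?H n)) - 0) < e"
      using H by (simp add: field_simps)
  qed
qed

section \<open>Density of the points divisible by d\<close>

text \<open>Subtracting all tuples with entries \<open>a k < d\<close> from a point with coordinates
  divisible by \<open>d\<close> gives \<open>d ^ r\<close> points. They stay in the region, since
  coordinates decrease but remain positive, and different points yield disjoint boxes.\<close>

lemma card_multiples_le:
  assumes l: "1 \<le> l" "l \<le> r" and d: "1 \<le> d"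
  shows "d ^ r * card {x \<in> hyperbolic_region l r n. \<forall>k\<in>{1..r}. d dvd x k}
           \<le> card (hyperbolic_region l r n)"
proof -
  let ?H = "hyperbolic_region l r n"
  define A where "A = {x \<in> ?H. \<forall>k\<in>{1..r}. d dvd x k}"
  define g where "g = (\<lambda>(x, a). \<lambda>k\<in>{1..r}. x k - a k :: nat)"
  have le: "a k < x k" if "x \<in> A" "a \<in> {1..r} \<rightarrow>\<^sub>E {..<d}" "k \<in> {1..r}" for x a k
  proof -
    have "1 \<le> x k" "d dvd x k" using that by (auto simp: A_def hyperbolic_region_def PiE_def Pi_def)
    then have "d \<le> x k" by (auto intro: dvd_imp_le)
    moreover have "a k < d" using that by (auto simp: PiE_def Pi_def)
    ultimately show ?thesis by simp
  qed
  have "card (A \<times> ({1..r} \<rightarrow>\<^sub>E {..<d})) \<le> card ?H"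
  proof (rule card_inj_on_le[of g])
    show "inj_on g (A \<times> ({1..r} \<rightarrow>\<^sub>E {..<d}))"
    proof (rule inj_onI, clarify)
      fix x a y b
      assume xa: "x \<in> A" "a \<in> {1..r} \<rightarrow>\<^sub>E {..<d}" and yb: "y \<in> A" "b \<in> {1..r} \<rightarrow>\<^sub>E {..<d}"
        and eq: "g (x, a) = g (y, b)"
      have k: "x k = y k \<and> a k = b k" if k: "k \<in> {1..r}" for k
      proof -
        have "x k - a k = y k - b k" using fun_cong[OF eq, of k] k by (simp add: g_def)
        \<comment> \<open>Written without truncated subtraction, the equation can be reduced modulo
          \<open>d\<close>, where \<open>x k\<close> and \<open>y k\<close> vanish and
          \<open>b k = a k\<close> remains.\<close>
        then have s: "x k + b k = y k + a k"
          using le[OF xa k] le[OF yb k] by linarith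
        have "b k < d" "a k < d" using xa yb k by (auto simp: PiE_def Pi_def)
        moreover have "d dvd x k" "d dvd y k" using xa yb k by (auto simp: A_def)
        ultimately have "b k = a k"
          using arg_cong[OF s, of "\<lambda>t. t mod d"]
          by (metis add.left_neutral dvd_imp_mod_0 mod_add_left_eq mod_less)
        then show ?thesis using s by simp
      qed
      have "x = y"
        by (rule PiE_ext[of _ "{1..r}" "\<lambda>_. {1..}"]) (use xa yb k in \<open>auto simp: A_def hyperbolic_region_def\<close>)
      moreover have "a = b"
        by (rule PiE_ext) (use xa yb k in auto)
      ultimately show "x = y \<and> a = b" by simp
    qed
    show "g ` (A \<times> ({1..r} \<rightarrow>\<^sub>E {..<d})) \<subseteq> ?H"
    proof clarify
      fix x a assume xa: "x \<in> A" "a \<in> {1..r} \<rightarrow>\<^sub>E {..<d}"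
      show "g (x, a) \<in> ?H"
        by (rule hyperbolic_region_downward_closed[of x])
          (use xa le[OF xa] in \<open>auto simp: A_def g_def Suc_le_eq\<close>)
    qed
  qed (rule finite_hyperbolic_region[OF l])
  then show ?thesis by (simp add: card_cartesian_product card_PiE A_def mult.commute)
qed

text \<open>The region is downward closed, and resetting a constant coordinate to 1 loses no
  information.\<close>

lemma card_slice_antimono:
  assumes l: "1 \<le> l" "l \<le> r" and i: "i \<in> {1..r}"
  shows "card {x \<in> hyperbolic_region l r n. x i = c}
           \<le> card {x \<in> hyperbolic_region l r n. x i = 1}"
proof (rule card_inj_on_le[of "\<lambda>x. x(i := 1)"])
  show "inj_on (\<lambda>x. x(i := 1)) {x \<in> hyperbolic_region l r n. x i = c}"
  proof (rule inj_onI)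
    fix x y assume *: "x \<in> {x \<in> hyperbolic_region l r n. x i = c}"
      "y \<in> {x \<in> hyperbolic_region l r n. x i = c}" "x(i := 1) = y(i := 1)"
    show "x = y"
    proof
      fix k show "x k = y k" using fun_cong[OF *(3), of k] * by (cases "k = i") auto
    qed
  qed
  have "x(i := 1) \<in> hyperbolic_region l r n" if x: "x \<in> hyperbolic_region l r n" for x
    by (rule hyperbolic_region_downward_closed[OF x])
      (use x i in \<open>auto simp: hyperbolic_region_def PiE_def Pi_def extensional_def\<close>)
  then show "(\<lambda>x. x(i := 1)) ` {x \<in> hyperbolic_region l r n. x i = c}
      \<subseteq> {x \<in> hyperbolic_region l r n. x i = 1}" by auto
qed (use finite_hyperbolic_region[OF l] in auto)

text \<open>A point with all coordinates at least \<open>d\<close> is determined by its residues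
  together with its coordinates rounded down to positive multiples of \<open>d\<close>. Any other
  point lies in a slice \<open>x i = c\<close> with \<open>c < d\<close>, which is no larger than
  the slice at 1.\<close>

lemma card_le_multiples:
  assumes l: "1 \<le> l" "l \<le> r" and d: "1 \<le> d"
  shows "card (hyperbolic_region l r n)
           \<le> d ^ r * card {x \<in> hyperbolic_region l r n. \<forall>k\<in>{1..r}. d dvd x k} +
             d * (\<Sum>i=1..r. card {x \<in> hyperbolic_region l r n. x i = 1})"
proof -
  let ?H = "hyperbolic_region l r n"
  define A where "A = {x \<in> ?H. \<forall>k\<in>{1..r}. d dvd x k}"
  define B where "B = {x \<in> ?H. \<forall>k\<in>{1..r}. d \<le> x k}"
  define g where "g x = ((\<lambda>k\<in>{1..r}. x k mod d), (\<lambda>k\<in>{1..r}. d * (x k div d)))" for x :: "nat \<Rightarrow> nat"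
  have finH: "finite ?H" by (rule finite_hyperbolic_region[OF l])
  have "card B \<le> card (({1..r} \<rightarrow>\<^sub>E {..<d}) \<times> A)"
  proof (rule card_inj_on_le[of g])
    show "inj_on g B"
    proof (rule inj_onI)
      fix x y assume *: "x \<in> B" "y \<in> B" "g x = g y"
      have "x k = y k" if "k \<in> {1..r}" for k
      proof -
        have "(\<lambda>k\<in>{1..r}. x k mod d) k = (\<lambda>k\<in>{1..r}. y k mod d) k"
          "(\<lambda>k\<in>{1..r}. d * (x k div d)) k = (\<lambda>k\<in>{1..r}. d * (y k div d)) k"
          using *(3) by (auto simp: g_def dest: fun_cong)
        then have "x k mod d = y k mod d" "x k div d = y k div d"
          using that d by auto
        then show ?thesis by (metis mult_div_mod_eq)
      qed
      then show "x = y"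
        by (intro PiE_ext[of _ "{1..r}" "\<lambda>_. {1..}"])
          (use * in \<open>auto simp: B_def hyperbolic_region_def\<close>)
    qed
    show "g ` B \<subseteq> ({1..r} \<rightarrow>\<^sub>E {..<d}) \<times> A"
    proof clarify
      fix x a b assume x: "x \<in> B" and g: "(a, b) = g x"
      then have ab: "a = (\<lambda>k\<in>{1..r}. x k mod d)" "b = (\<lambda>k\<in>{1..r}. d * (x k div d))"
        by (auto simp: g_def)
      have ge: "1 \<le> d * (x k div d)" if "k \<in> {1..r}" for k
      proof -
        have "d \<le> x k" using x that by (auto simp: B_def)
        then have "1 \<le> x k div d" using d by (metis div_le_mono div_self le_zero_eq not_one_le_zero)
        then show ?thesis using d by simp
      qed
      have "b \<in> ?H"
        by (rule hyperbolic_region_downward_closed[of x]) (use x ge in \<open>auto simp: B_def ab\<close>)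
      then show "a \<in> {1..r} \<rightarrow>\<^sub>E {..<d} \<and> b \<in> A"
        using d by (auto simp: A_def ab)
    qed
  qed (use finH in \<open>auto simp: A_def intro!: finite_PiE\<close>)
  then have B: "card B \<le> d ^ r * card A"
    by (simp add: card_cartesian_product card_PiE)
  have "?H \<subseteq> B \<union> (\<Union>i\<in>{1..r}. \<Union>c\<in>{..<d}. {x \<in> ?H. x i = c})"
    by (auto simp: B_def)
  then have "card ?H \<le> card (B \<union> (\<Union>i\<in>{1..r}. \<Union>c\<in>{..<d}. {x \<in> ?H. x i = c}))"
    using finH by (intro card_mono) (auto simp: B_def)
  also have "\<dots> \<le> card B + card (\<Union>i\<in>{1..r}. \<Union>c\<in>{..<d}. {x \<in> ?H. x i = c})"
    by (rule card_Un_le)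
  also have "card (\<Union>i\<in>{1..r}. \<Union>c\<in>{..<d}. {x \<in> ?H. x i = c})
      \<le> (\<Sum>i\<in>{1..r}. card (\<Union>c\<in>{..<d}. {x \<in> ?H. x i = c}))"
    by (rule card_UN_le) simp
  also have "\<dots> \<le> (\<Sum>i\<in>{1..r}. \<Sum>c\<in>{..<d}. card {x \<in> ?H. x i = c})"
    by (intro sum_mono card_UN_le) simp
  also have "\<dots> \<le> (\<Sum>i\<in>{1..r}. \<Sum>c\<in>{..<d}. card {x \<in> ?H. x i = 1})"
    by (intro sum_mono card_slice_antimono[OF l]) simp
  also have "\<dots> = d * (\<Sum>i=1..r. card {x \<in> ?H. x i = 1})"
    by (simp add: sum_distrib_left)
  finally show ?thesis using B by (simp add: A_def)
qed

lemma density_of_multiples: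
  assumes l: "1 \<le> l" "l \<le> r" and d: "1 \<le> d"
  shows "(\<lambda>n. real (card {x \<in> hyperbolic_region l r n. \<forall>k\<in>{1..r}. d dvd x k}) /
                real (card (hyperbolic_region l r n))) \<longlonglongrightarrow> 1 / real d ^ r"
proof -
  let ?H = "hyperbolic_region l r"
  define A where "A n = real (card {x \<in> ?H n. \<forall>k\<in>{1..r}. d dvd x k})" for n
  define N where "N i n = real (card {x \<in> ?H n. x i = 1})" for i n
  define h where "h n = real (card (?H n))" for n
  have dr: "real d ^ r > 0" using d by simp
  have ev: "\<forall>\<^sub>F n in sequentially. h n > 0"
    using filterlim_card_hyperbolic_region[OF l] unfolding filterlim_at_top_dense h_def by blast
  have "(\<lambda>n. A n / h n) \<longlonglongrightarrow> 1 / real d ^ r"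
  proof (rule tendsto_sandwich)
    \<comment> \<open>The lower bound is \<open>card_le_multiples\<close> divided by
      \<open>d ^ r * h n\<close>, whose slice terms tend to 0; the upper bound is
      \<open>card_multiples_le\<close>.\<close>
    show "(\<lambda>n. 1 / real d ^ r * (1 - d * (\<Sum>i=1..r. N i n / h n))) \<longlonglongrightarrow> 1 / real d ^ r"
    proof -
      have "(\<lambda>n. 1 / real d ^ r * (1 - d * (\<Sum>i=1..r. N i n / h n)))
          \<longlonglongrightarrow> 1 / real d ^ r * (1 - real d * (\<Sum>i=1..r. 0))"
        unfolding N_def h_def
        by (intro tendsto_mult tendsto_diff tendsto_const tendsto_sum slice_one_negligible[OF l])
      then show ?thesis by simp
    qed
    show "\<forall>\<^sub>F n in sequentially. A n / h n \<le> 1 / real d ^ r"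
      using ev
    proof eventually_elim
      case (elim n)
      have "real d ^ r * A n \<le> h n"
        using card_multiples_le[OF l d, of n, THEN of_nat_mono[where 'a = real]] by (simp add: A_def h_def)
      then show ?case using elim dr by (simp add: field_simps)
    qed
    show "\<forall>\<^sub>F n in sequentially. 1 / real d ^ r * (1 - d * (\<Sum>i=1..r. N i n / h n)) \<le> A n / h n"
      using ev
    proof eventually_elim
      case (elim n)
      have "h n \<le> real d ^ r * A n + d * (\<Sum>i=1..r. N i n)"
        using card_le_multiples[OF l d, of n, THEN of_nat_mono[where 'a = real]]
        by (simp add: A_def h_def N_def)
      then have "h n * (1 - d * (\<Sum>i=1..r. N i n / h n)) \<le> real d ^ r * A n"
        using elim by (simp add: sum_divide_distrib[symmetric] right_diff_distrib)
      then show ?case using elim dr by (simp add: field_simps)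
    qed
  qed simp
  then show ?thesis by (simp add: A_def h_def)
qed

subsection \<open>Convergence of laws from divisibility probabilities\<close>

text \<open>As \<open>e dvd D\<close>, divisibility of \<open>Y\<close> by \<open>e\<close> is
  visible in the gcd of \<open>Y\<close> and \<open>D\<close>, which has finitely many possible
  values.\<close>

lemma (in finite_measure) measure_dvd_eq_sum_gcd:
  fixes Y :: "'a \<Rightarrow> nat"
  assumes [measurable]: "Y \<in> measurable M (count_space UNIV)" and D: "D > 0" and e: "e dvd D"
  shows "measure M {\<omega> \<in> space M. e dvd Y \<omega>} =
           (\<Sum>m | e dvd m \<and> m dvd D. measure M {\<omega> \<in> space M. gcd (Y \<omega>) D = m})"
proof -
  have fin: "finite {m. e dvd m \<and> m dvd D}"
    using D by (auto intro: finite_subset[OF _ finite_divisors_nat[of D]])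
  have "{\<omega> \<in> space M. e dvd Y \<omega>} =
      (\<Union>m\<in>{m. e dvd m \<and> m dvd D}. {\<omega> \<in> space M. gcd (Y \<omega>) D = m})"
    using e by auto
  then show ?thesis
    using fin by (auto intro!: finite_measure_finite_Union simp: disjoint_family_on_def)
qed

text \<open>Isolating the term \<open>m\<close> of the preceding sum leaves only proper multiples of
  \<open>m\<close>. This recursion takes the place of an explicit Moebius inversion.\<close>

lemma (in finite_measure) measure_gcd_eq_diff:
  fixes Y :: "'a \<Rightarrow> nat"
  assumes "Y \<in> measurable M (count_space UNIV)" and D: "D > 0" and m: "m dvd D"
  shows "measure M {\<omega> \<in> space M. gcd (Y \<omega>) D = m} =
           measure M {\<omega> \<in> space M. m dvd Y \<omega>} -
           (\<Sum>m'\<in>{m'. m dvd m' \<and> m' dvd D} - {m}. measure M {\<omega> \<in> space M. gcd (Y \<omega>) D = m'})"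
proof -
  have "finite {m'. m dvd m' \<and> m' dvd D}"
    using D by (auto intro: finite_subset[OF _ finite_divisors_nat[of D]])
  then show ?thesis
    using measure_dvd_eq_sum_gcd[OF assms] m by (simp add: sum.remove[of _ m])
qed

lemma tendsto_measure_gcd:
  fixes X :: "nat \<Rightarrow> 'a \<Rightarrow> nat" and Y :: "'b \<Rightarrow> nat"
  assumes ev: "\<forall>\<^sub>F n in sequentially. prob_space (N n) \<and> X n \<in> measurable (N n) (count_space UNIV)"
    and M: "prob_space M" and Y: "Y \<in> measurable M (count_space UNIV)"
    and lim: "\<And>d. d > 0 \<Longrightarrow> (\<lambda>n. measure (N n) {\<omega> \<in> space (N n). d dvd X n \<omega>})
                \<longlonglongrightarrow> measure M {\<omega> \<in> space M. d dvd Y \<omega>}"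
    and D: "D > 0" and m: "m dvd D"
  shows "(\<lambda>n. measure (N n) {\<omega> \<in> space (N n). gcd (X n \<omega>) D = m})
           \<longlonglongrightarrow> measure M {\<omega> \<in> space M. gcd (Y \<omega>) D = m}"
  using m
\<comment> \<open>Downward induction through the divisors of \<open>D\<close>: the subtracted terms
  belong to proper multiples \<open>m'\<close> of \<open>m\<close>, where
  \<open>D - m' < D - m\<close>. At \<open>m = D\<close> the sum is empty.\<close>
proof (induction m rule: measure_induct_rule[where f = "\<lambda>m. D - m"])
  case (less m)
  let ?S = "{m'. m dvd m' \<and> m' dvd D}"
  have m0: "m > 0" using less.prems D by (auto intro: Nat.gr0I)
  note eq = finite_measure.measure_gcd_eq_diff[OF _ _ D less.prems]
  have "(\<lambda>n. measure (N n) {\<omega> \<in> space (N n). m dvd X n \<omega>} -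
        (\<Sum>m'\<in>?S - {m}. measure (N n) {\<omega> \<in> space (N n). gcd (X n \<omega>) D = m'}))
      \<longlonglongrightarrow> measure M {\<omega> \<in> space M. m dvd Y \<omega>} -
        (\<Sum>m'\<in>?S - {m}. measure M {\<omega> \<in> space M. gcd (Y \<omega>) D = m'})"
  proof (intro tendsto_diff lim m0 tendsto_sum)
    fix m' assume m': "m' \<in> ?S - {m}"
    then have "m' > 0" "m' \<le> D" using D by (auto intro: dvd_imp_le Nat.gr0I)
    moreover have "m < m'"
      using m' \<open>m' > 0\<close> by (auto dest: dvd_imp_le)
    ultimately show "(\<lambda>n. measure (N n) {\<omega> \<in> space (N n). gcd (X n \<omega>) D = m'})
        \<longlonglongrightarrow> measure M {\<omega> \<in> space M. gcd (Y \<omega>) D = m'}"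
      using m' by (intro less.IH) auto
  qed
  then have "(\<lambda>n. measure (N n) {\<omega> \<in> space (N n). m dvd X n \<omega>} -
        (\<Sum>m'\<in>?S - {m}. measure (N n) {\<omega> \<in> space (N n). gcd (X n \<omega>) D = m'}))
      \<longlonglongrightarrow> measure M {\<omega> \<in> space M. gcd (Y \<omega>) D = m}"
    by (simp only: eq[OF prob_space.finite_measure[OF M] Y])
  moreover have "\<forall>\<^sub>F n in sequentially. measure (N n) {\<omega> \<in> space (N n). m dvd X n \<omega>} -
        (\<Sum>m'\<in>?S - {m}. measure (N n) {\<omega> \<in> space (N n). gcd (X n \<omega>) D = m'}) =
      measure (N n) {\<omega> \<in> space (N n). gcd (X n \<omega>) D = m}"
    using ev by eventually_elim (auto simp: eq[OF prob_space.finite_measure])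
  ultimately show ?case by (rule Lim_transform_eventually)
qed

text \<open>Passing to the gcd with \<open>D\<close> makes the expectation a finite sum, so termwise
  convergence of the probabilities suffices.\<close>

lemma (in prob_space) expectation_gcd_eq_sum:
  fixes Y :: "'a \<Rightarrow> nat" and h :: "nat \<Rightarrow> real"
  assumes [measurable]: "Y \<in> measurable M (count_space UNIV)" and D: "D > 0"
  shows "expectation (\<lambda>\<omega>. h (gcd (Y \<omega>) D)) =
           (\<Sum>m | m dvd D. h m * prob {\<omega> \<in> space M. gcd (Y \<omega>) D = m})"
proof -
  have fin: "finite {m. m dvd D}" using D by (rule finite_divisors_nat)
  have "expectation (\<lambda>\<omega>. h (gcd (Y \<omega>) D)) =
      expectation (\<lambda>\<omega>. \<Sum>m | m dvd D. h m * indicator {\<omega> \<in> space M. gcd (Y \<omega>) D = m} \<omega>)"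
  proof (rule Bochner_Integration.integral_cong)
    fix \<omega> assume "\<omega> \<in> space M"
    then have "(\<Sum>m | m dvd D. h m * indicator {\<omega> \<in> space M. gcd (Y \<omega>) D = m} \<omega>) =
        (\<Sum>m | m dvd D. if m = gcd (Y \<omega>) D then h m else 0)"
      by (intro sum.cong) (auto simp: indicator_def)
    then show "h (gcd (Y \<omega>) D) = (\<Sum>m | m dvd D. h m * indicator {\<omega> \<in> space M. gcd (Y \<omega>) D = m} \<omega>)"
      using fin by simp
  qed simp
  also have "\<dots> = (\<Sum>m | m dvd D. h m * prob {\<omega> \<in> space M. gcd (Y \<omega>) D = m})"
    by (subst Bochner_Integration.integral_sum) (auto simp: emeasure_eq_measure)
  finally show ?thesis .
qed

text \<open>If \<open>1 \<le> Y \<le> K\<close> then \<open>gcd Y (K!) = Y\<close>; otherwise \<open>Y\<close> has a divisor exceeding \<open>K\<close>.\<close>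
lemma (in prob_space) expectation_gcd_fact_approx:
  fixes Y :: "'a \<Rightarrow> nat" and h :: "nat \<Rightarrow> real"
  assumes Y[measurable]: "Y \<in> measurable M (count_space UNIV)"
    and h: "\<And>m. \<bar>h m\<bar> \<le> b"
    and u: "summable u" and le: "\<And>d. d > 0 \<Longrightarrow> prob {\<omega> \<in> space M. d dvd Y \<omega>} \<le> u d"
  shows "\<bar>expectation (\<lambda>\<omega>. h (Y \<omega>)) - expectation (\<lambda>\<omega>. h (gcd (Y \<omega>) (fact K)))\<bar>
           \<le> 2 * b * (\<Sum>i. u (i + Suc K))"
proof -
  have b: "b \<ge> 0" using h[of 0] by linarith
  \<comment> \<open>The shift runs through exactly the divisors exceeding \<open>K\<close>. A point
    with \<open>Y \<omega> = 0\<close> lies in every \<open>A i\<close>, so off \<open>E\<close> the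
    value is positive.\<close>
  define A where "A i = {\<omega> \<in> space M. (i + Suc K) dvd Y \<omega>}" for i
  define E where "E = (\<Union>i. A i)"
  have [measurable]: "A i \<in> events" for i by (simp add: A_def)
  have [measurable]: "E \<in> events" unfolding E_def by measurable
  have su: "summable (\<lambda>i. u (i + Suc K))" using u by (rule summable_ignore_initial_segment)
  have Au: "prob (A i) \<le> u (i + Suc K)" for i unfolding A_def by (rule le) simp
  have sA: "summable (\<lambda>i. prob (A i))"
    by (rule summable_comparison_test'[OF su, of 0]) (use Au in simp)
  have "prob E \<le> (\<Sum>i. prob (A i))"
    unfolding E_def by (rule finite_measure_subadditive_countably) (use sA in auto)
  also have "\<dots> \<le> (\<Sum>i. u (i + Suc K))"
    by (intro suminf_le Au sA su)
  finally have E: "prob E \<le> (\<Sum>i. u (i + Suc K))" .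
  have eq: "gcd (Y \<omega>) (fact K) = Y \<omega>" if \<omega>: "\<omega> \<in> space M" "\<omega> \<notin> E" for \<omega>
  proof -
    have nd: "\<not> (i + Suc K) dvd Y \<omega>" for i using \<omega> by (auto simp: E_def A_def)
    have "Y \<omega> \<noteq> 0" using nd[of 0] by (metis dvd_0_right)
    moreover have "Y \<omega> \<le> K"
    proof (rule ccontr)
      assume "\<not> Y \<omega> \<le> K"
      then have "Y \<omega> = (Y \<omega> - Suc K) + Suc K" by simp
      with nd show False by (metis dvd_refl)
    qed
    ultimately have "Y \<omega> dvd fact K" by (intro dvd_fact) auto
    then show ?thesis by simp
  qed
  have int: "integrable M (\<lambda>\<omega>. h (Z \<omega>))" if [measurable]: "Z \<in> measurable M (count_space UNIV)" for Z
    by (rule integrable_const_bound[where B = b]) (use h in auto)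
  have int1: "integrable M (\<lambda>\<omega>. h (Y \<omega>))" by (rule int) simp
  have int2: "integrable M (\<lambda>\<omega>. h (gcd (Y \<omega>) (fact K)))"
    by (rule int) measurable
  have "expectation (\<lambda>\<omega>. h (Y \<omega>)) - expectation (\<lambda>\<omega>. h (gcd (Y \<omega>) (fact K))) =
      expectation (\<lambda>\<omega>. h (Y \<omega>) - h (gcd (Y \<omega>) (fact K)))"
    using int1 int2 by simp
  also have "\<bar>\<dots>\<bar> \<le> expectation (\<lambda>\<omega>. \<bar>h (Y \<omega>) - h (gcd (Y \<omega>) (fact K))\<bar>)"
    by (rule integral_abs_bound)
  also have "\<dots> \<le> expectation (\<lambda>\<omega>. 2 * b * indicator E \<omega>)"
  proof (rule integral_mono)
    show "integrable M (\<lambda>\<omega>. \<bar>h (Y \<omega>) - h (gcd (Y \<omega>) (fact K))\<bar>)"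
      using int1 int2 by auto
    show "integrable M (\<lambda>\<omega>. 2 * b * indicator E \<omega>)"
      by (auto simp: emeasure_eq_measure)
    fix \<omega> assume "\<omega> \<in> space M"
    then show "\<bar>h (Y \<omega>) - h (gcd (Y \<omega>) (fact K))\<bar> \<le> 2 * b * indicator E \<omega>"
      using eq[of \<omega>] h[of "Y \<omega>"] h[of "gcd (Y \<omega>) (fact K)"] by (auto simp: indicator_def)
  qed
  also have "\<dots> = 2 * b * prob E" by (simp add: emeasure_eq_measure)
  also have "\<dots> \<le> 2 * b * (\<Sum>i. u (i + Suc K))"
    using E b by (intro mult_left_mono) auto
  finally show ?thesis .
qed

text \<open>Three-epsilon argument: replacing both variables by their gcd with \<open>fact K\<close>
  costs at most a multiple of a tail of \<open>u\<close>, uniformly in large \<open>n\<close>. For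
  fixed \<open>K\<close> a finite sum with convergent terms remains.\<close>

lemma tendsto_expectation_of_tendsto_dvd:
  fixes X :: "nat \<Rightarrow> 'a \<Rightarrow> nat" and Y :: "'b \<Rightarrow> nat" and h :: "nat \<Rightarrow> real"
  assumes ev: "\<forall>\<^sub>F n in sequentially. prob_space (N n) \<and> X n \<in> measurable (N n) (count_space UNIV)"
    and bound: "\<forall>\<^sub>F n in sequentially. \<forall>d>0. measure (N n) {\<omega> \<in> space (N n). d dvd X n \<omega>} \<le> u d"
    and M: "prob_space M" and Y: "Y \<in> measurable M (count_space UNIV)"
    and lim: "\<And>d. d > 0 \<Longrightarrow> (\<lambda>n. measure (N n) {\<omega> \<in> space (N n). d dvd X n \<omega>})
                \<longlonglongrightarrow> measure M {\<omega> \<in> space M. d dvd Y \<omega>}"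
    and u: "summable u" and h: "\<And>m. \<bar>h m\<bar> \<le> b"
  shows "(\<lambda>n. \<integral>\<omega>. h (X n \<omega>) \<partial>N n) \<longlonglongrightarrow> (\<integral>\<omega>. h (Y \<omega>) \<partial>M)"
proof (rule LIMSEQ_I)
  fix e :: real assume e: "e > 0"
  interpret M: prob_space M by fact
  \<comment> \<open>The domination by \<open>u\<close> passes to the limit, so one \<open>K\<close>
    serves both approximations.\<close>
  have boundY: "measure M {\<omega> \<in> space M. d dvd Y \<omega>} \<le> u d" if "d > 0" for d
    by (rule tendsto_upperbound[OF lim[OF that]]) (use bound that in \<open>auto elim: eventually_mono\<close>)
  have "(\<lambda>K. 2 * b * (\<Sum>i. u (i + Suc K))) \<longlonglongrightarrow> 2 * b * 0"
    by (intro tendsto_mult tendsto_const LIMSEQ_Suc suminf_exist_split2 u)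
  then have "\<forall>\<^sub>F K in sequentially. 2 * b * (\<Sum>i. u (i + Suc K)) < e / 3"
    using e by (intro order_tendstoD) auto
  then obtain K where K: "2 * b * (\<Sum>i. u (i + Suc K)) < e / 3"
    by (auto simp: eventually_sequentially)
  let ?TN = "\<lambda>n. \<Sum>m | m dvd fact K. h m * measure (N n) {\<omega> \<in> space (N n). gcd (X n \<omega>) (fact K) = m}"
  let ?TM = "\<Sum>m | m dvd fact K. h m * measure M {\<omega> \<in> space M. gcd (Y \<omega>) (fact K) = m}"
  have "?TN \<longlonglongrightarrow> ?TM"
    by (intro tendsto_sum tendsto_mult tendsto_const tendsto_measure_gcd[OF ev M Y lim]) auto
  then have "\<forall>\<^sub>F n in sequentially. dist (?TN n) ?TM < e / 3"
    using e by (intro tendstoD) auto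
  with ev bound have "\<forall>\<^sub>F n in sequentially. norm ((\<integral>\<omega>. h (X n \<omega>) \<partial>N n) - (\<integral>\<omega>. h (Y \<omega>) \<partial>M)) < e"
  proof eventually_elim
    case (elim n)
    interpret N: prob_space "N n" using elim by simp
    have X: "X n \<in> measurable (N n) (count_space UNIV)" using elim by simp
    have "\<bar>(\<integral>\<omega>. h (X n \<omega>) \<partial>N n) - ?TN n\<bar> < e / 3"
      using N.expectation_gcd_fact_approx[where h = h, OF X h u, where K = K] N.expectation_gcd_eq_sum[OF X, of "fact K" h]
        elim K by simp
    moreover have "\<bar>(\<integral>\<omega>. h (Y \<omega>) \<partial>M) - ?TM\<bar> < e / 3"
      using M.expectation_gcd_fact_approx[where h = h, OF Y h u boundY, where K = K] M.expectation_gcd_eq_sum[OF Y, of "fact K" h]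
        K by simp
    ultimately show ?case
      using elim(3) unfolding dist_real_def real_norm_def by linarith
  qed
  then show "\<exists>no. \<forall>n\<ge>no. norm ((\<integral>\<omega>. h (X n \<omega>) \<partial>N n) - (\<integral>\<omega>. h (Y \<omega>) \<partial>M)) < e"
    by (simp add: eventually_sequentially)
qed

subsection \<open>The limit law\<close>

lemma measurable_prod_nat_count_space:
  fixes F :: "'i \<Rightarrow> 'a \<Rightarrow> nat"
  assumes "\<And>i. F i \<in> measurable M (count_space UNIV)"
  shows "(\<lambda>\<omega>. \<Prod>i\<in>I. F i \<omega>) \<in> measurable M (count_space UNIV)"
proof (induction I rule: infinite_finite_induct)
  case (insert i I)
  have "(\<lambda>\<omega>. F i \<omega> * (\<Prod>i\<in>I. F i \<omega>)) \<in> measurable M (count_space UNIV)"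
    by (rule measurable_compose_countable[OF _ assms])
      (rule measurable_compose[OF insert.IH], simp)
  then show ?case using insert by simp
qed simp_all

text \<open>Having product \<open>q\<close> means that the partial products are eventually equal to
  \<open>q\<close>, a countable condition for each of countably many \<open>q\<close>. Points of
  divergence, where \<open>prodinf\<close> takes a default value, are covered by measurability of
  \<open>THE\<close>.\<close>

lemma measurable_prodinf_nat:
  fixes F :: "nat \<Rightarrow> 'a \<Rightarrow> nat"
  assumes F: "\<And>i. F i \<in> measurable M (count_space UNIV)"
    and pos: "\<And>i \<omega>. F i \<omega> \<noteq> 0"
  shows "(\<lambda>\<omega>. \<Prod>i. F i \<omega>) \<in> measurable M (count_space UNIV)"
  unfolding prodinf_def
proof (rule measurable_THE[where I = UNIV])
  fix q
  have [measurable]: "(\<lambda>\<omega>. \<Prod>i\<le>n. F i \<omega>) \<in> measurable M (count_space UNIV)" for n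
    by (rule measurable_prod_nat_count_space[OF F])
  \<comment> \<open>\<open>pos\<close> rules out the clause of \<open>has_prod\<close> for zero
    factors, and convergence in a discrete space is eventual equality.\<close>
  have "(\<lambda>\<omega>. (\<lambda>i. F i \<omega>) has_prod q) =
      (\<lambda>\<omega>. (\<exists>n0. \<forall>n\<ge>n0. (\<Prod>i\<le>n. F i \<omega>) = q) \<and> q \<noteq> 0)"
    by (simp add: has_prod_def raw_has_prod_def pos tendsto_discrete eventually_sequentially)
  then show "Measurable.pred M (\<lambda>\<omega>. (\<lambda>i. F i \<omega>) has_prod q)"
    by simp
qed (auto intro: has_prod_unique2)

text \<open>The minimum is at least \<open>j\<close> on a finite intersection of events, and each
  level set is the difference of two such events.\<close>

lemma measurable_Min_image:
  fixes g :: "'i \<Rightarrow> 'a \<Rightarrow> nat"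
  assumes K: "finite K" "K \<noteq> {}"
    and [measurable]: "\<And>k. k \<in> K \<Longrightarrow> g k \<in> measurable M (count_space UNIV)"
  shows "(\<lambda>\<omega>. MIN k\<in>K. g k \<omega>) \<in> measurable M (count_space UNIV)"
proof -
  have "{\<omega> \<in> space M. j \<le> (MIN k\<in>K. g k \<omega>)} = {\<omega> \<in> space M. \<forall>k\<in>K. j \<le> g k \<omega>}" for j
    using K by simp
  moreover have "{\<omega> \<in> space M. \<forall>k\<in>K. j \<le> g k \<omega>} \<in> sets M" for j
    using K(1) by measurable
  ultimately have "{\<omega> \<in> space M. j \<le> (MIN k\<in>K. g k \<omega>)} \<in> sets M" for j
    by simp
  then have "{\<omega> \<in> space M. a \<le> (MIN k\<in>K. g k \<omega>)} - {\<omega> \<in> space M. Suc a \<le> (MIN k\<in>K. g k \<omega>)} \<in> sets M" for a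
    by blast
  moreover have "(\<lambda>\<omega>. MIN k\<in>K. g k \<omega>) -` {a} \<inter> space M =
      {\<omega> \<in> space M. a \<le> (MIN k\<in>K. g k \<omega>)} - {\<omega> \<in> space M. Suc a \<le> (MIN k\<in>K. g k \<omega>)}" for a
    by (auto simp del: Min_ge_iff)
  ultimately show ?thesis
    by (subst measurable_count_space_eq2_countable) auto
qed

text \<open>Induction by \<open>q ^ j - (1 - q) * q ^ j = q ^ (j + 1)\<close>. Tails are the
  convenient form because they behave well under minima.\<close>

lemma (in prob_space) prob_geometric_ge:
  fixes X :: "'a \<Rightarrow> nat" and q :: real
  assumes [measurable]: "X \<in> measurable M (count_space UNIV)"
    and eq: "\<And>j. prob {\<omega> \<in> space M. X \<omega> = j} = (1 - q) * q ^ j"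
  shows "prob {\<omega> \<in> space M. j \<le> X \<omega>} = q ^ j"
proof (induction j)
  case 0
  then show ?case by (simp add: prob_space)
next
  case (Suc j)
  have "{\<omega> \<in> space M. j \<le> X \<omega>} = {\<omega> \<in> space M. X \<omega> = j} \<union> {\<omega> \<in> space M. Suc j \<le> X \<omega>}"
    by auto
  then have "prob {\<omega> \<in> space M. j \<le> X \<omega>} =
      prob {\<omega> \<in> space M. X \<omega> = j} + prob {\<omega> \<in> space M. Suc j \<le> X \<omega>}"
    by (simp only:) (rule finite_measure_Union; auto)
  with Suc eq[of j] show ?case by (simp add: algebra_simps)
qed

section \<open>Random exponents and their product\<close>

locale geometric_exponents = prob_space M for M :: "'b measure" +
  fixes G :: "nat \<Rightarrow> nat \<Rightarrow> 'b \<Rightarrow> nat" and r :: nat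
  assumes r: "2 \<le> r"
    and indep: "indep_vars (\<lambda>_. count_space UNIV) (\<lambda>(k, p). G k p) ({1..} \<times> {p. prime p})"
    and geometric: "\<And>k p j. k \<ge> 1 \<Longrightarrow> prime p \<Longrightarrow>
           prob {\<omega> \<in> space M. G k p \<omega> = j} = (1 - 1 / real p) * (1 / real p) ^ j"
begin

definition exponent :: "nat \<Rightarrow> 'b \<Rightarrow> nat" where
  "exponent p \<omega> = (MIN k\<in>{1..r}. G k p \<omega>)"

text \<open>The product over primes is indexed by all naturals, with factor 1 at nonprimes. If
  infinitely many exponents are nonzero it diverges and its value is unspecified; this happens only
  on a null set.\<close>

definition limit_gcd :: "'b \<Rightarrow> nat" where
  "limit_gcd \<omega> = (\<Prod>p. if prime p then p ^ exponent p \<omega> else 1)"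

lemma measurable_G:
  assumes "1 \<le> k" "prime p"
  shows "G k p \<in> measurable M (count_space UNIV)"
  using indep assms by (auto simp: indep_vars_def)

lemma measurable_exponent [measurable]:
  assumes "prime p"
  shows "exponent p \<in> measurable M (count_space UNIV)"
  unfolding exponent_def using assms r by (intro measurable_Min_image measurable_G) auto

lemma measurable_limit_gcd [measurable]: "limit_gcd \<in> measurable M (count_space UNIV)"
  unfolding limit_gcd_def
proof (rule measurable_prodinf_nat)
  fix p :: nat
  show "(\<lambda>\<omega>. if prime p then p ^ exponent p \<omega> else 1) \<in> measurable M (count_space UNIV)"
    by (cases "prime p") (auto intro: measurable_compose[OF measurable_exponent])
  show "(if prime p then p ^ exponent p \<omega> else 1) \<noteq> 0" for \<omega> by (auto simp: prime_gt_0_nat)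
qed

text \<open>A minimum is at least \<open>a p\<close> iff every \<open>G k p\<close> is; joint
  independence in \<open>k\<close> and \<open>p\<close> then gives a product of geometric
  tails.\<close>

lemma prob_exponents_ge:
  assumes S: "finite S" "\<And>p. p \<in> S \<Longrightarrow> prime p"
  shows "prob {\<omega> \<in> space M. \<forall>p\<in>S. a p \<le> exponent p \<omega>} = (\<Prod>p\<in>S. (1 / real p) ^ a p) ^ r"
\<comment> \<open>Independence is invoked for nonempty index sets only.\<close>
proof (cases "S = {}")
  case True
  then show ?thesis by (simp add: prob_space)
next
  case False
  have "{\<omega> \<in> space M. \<forall>p\<in>S. a p \<le> exponent p \<omega>} =
      (\<Inter>i\<in>{1..r} \<times> S. (case i of (k, p) \<Rightarrow> G k p) -` (case i of (k, p) \<Rightarrow> {a p..}) \<inter> space M)"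
    using r False by (auto simp: exponent_def)
  also have "prob \<dots> = (\<Prod>i\<in>{1..r} \<times> S. prob ((case i of (k, p) \<Rightarrow> G k p) -` (case i of (k, p) \<Rightarrow> {a p..}) \<inter> space M))"
    using r False S by (intro indep_varsD[OF indep]) auto
  also have "\<dots> = (\<Prod>i\<in>{1..r} \<times> S. case i of (k, p) \<Rightarrow> (1 / real p) ^ a p)"
  proof (rule prod.cong[OF refl], clarify)
    fix k p assume "k \<in> {1..r}" "p \<in> S"
    then have "prob {\<omega> \<in> space M. a p \<le> G k p \<omega>} = (1 / real p) ^ a p"
      using S by (intro prob_geometric_ge measurable_G geometric) auto
    moreover have "G k p -` {a p..} \<inter> space M = {\<omega> \<in> space M. a p \<le> G k p \<omega>}" by auto
    ultimately show "prob (G k p -` {a p..} \<inter> space M) = (1 / real p) ^ a p" by simp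
  qed
  also have "\<dots> = (\<Prod>k\<in>{1..r}. \<Prod>p\<in>S. (1 / real p) ^ a p)"
    by (rule prod.cartesian_product[symmetric])
  finally show ?thesis by simp
qed

text \<open>Borel-Cantelli: a prime \<open>p\<close> has nonzero exponent with probability
  \<open>1 / p ^ r\<close>, which is summable since \<open>r \<ge> 2\<close>.\<close>

lemma AE_finite_exponents: "AE \<omega> in M. finite {p. prime p \<and> exponent p \<omega> \<noteq> 0}"
proof -
  \<comment> \<open>Empty events at nonprimes make this a sequence over all naturals.\<close>
  define A where "A p = (if prime p then {\<omega> \<in> space M. 1 \<le> exponent p \<omega>} else {})" for p
  have A: "A p \<in> events" for p
    by (cases "prime p") (auto simp: A_def)
  have "summable (\<lambda>p. 1 / real p ^ r)"
    using inverse_power_summable[OF r, where 'a = real] by (simp add: field_simps)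
  then have "summable (\<lambda>p. prob (A p))"
  proof (rule summable_comparison_test'[where N = 0])
    fix p :: nat
    show "norm (prob (A p)) \<le> 1 / real p ^ r"
      using prob_exponents_ge[of "{p}" "\<lambda>_. 1"] by (auto simp: A_def power_divide)
  qed
  then have "AE \<omega> in M. eventually (\<lambda>n. \<omega> \<in> space M - A n) sequentially"
    by (intro borel_cantelli_AE1 A) (auto simp: emeasure_eq_measure)
  then show ?thesis
  proof (rule AE_mp, intro AE_I2 impI)
    fix \<omega> assume \<omega>: "\<omega> \<in> space M" and "\<forall>\<^sub>F n in sequentially. \<omega> \<in> space M - A n"
    then obtain n0 where n0: "\<And>n. n \<ge> n0 \<Longrightarrow> \<omega> \<notin> A n"
      by (auto simp: eventually_sequentially)
    have "{p. prime p \<and> exponent p \<omega> \<noteq> 0} \<subseteq> {..<n0}"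
    proof
      fix p assume "p \<in> {p. prime p \<and> exponent p \<omega> \<noteq> 0}"
      then have "\<omega> \<in> A p" using \<omega> by (auto simp: A_def)
      then show "p \<in> {..<n0}" using n0[of p] by (auto simp: not_le[symmetric])
    qed
    then show "finite {p. prime p \<and> exponent p \<omega> \<noteq> 0}" by (rule finite_subset) simp
  qed
qed

text \<open>With finitely many nonzero exponents the infinite product is a genuine prime
  factorization with multiplicities \<open>exponent p \<omega>\<close>, and divisibility is
  comparison of multiplicities.\<close>

lemma dvd_limit_gcd_iff:
  assumes fin: "finite {p. prime p \<and> exponent p \<omega> \<noteq> 0}" and d: "d > 0"
  shows "d dvd limit_gcd \<omega> \<longleftrightarrow> (\<forall>p\<in>prime_factors d. multiplicity p d \<le> exponent p \<omega>)"
proof -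
  define S where "S = {p. prime p \<and> exponent p \<omega> \<noteq> 0}"
  have "limit_gcd \<omega> = (\<Prod>p\<in>S. if prime p then p ^ exponent p \<omega> else 1)"
    unfolding limit_gcd_def
    by (rule has_prod_unique[symmetric], rule has_prod_finite) (use fin in \<open>auto simp: S_def\<close>)
  also have "\<dots> = (\<Prod>p\<in>S. p ^ exponent p \<omega>)"
    by (intro prod.cong) (auto simp: S_def)
  finally have Y: "limit_gcd \<omega> = (\<Prod>p\<in>S. p ^ exponent p \<omega>)" .
  have Y0: "limit_gcd \<omega> \<noteq> 0"
    unfolding Y using fin by (auto simp: S_def)
  have mult: "multiplicity p (limit_gcd \<omega>) = exponent p \<omega>" if "prime p" for p
    unfolding Y using fin that by (subst multiplicity_prod_prime_powers) (auto simp: S_def)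
  show ?thesis
  proof
    assume "d dvd limit_gcd \<omega>"
    then have "multiplicity p d \<le> multiplicity p (limit_gcd \<omega>)" for p
      using Y0 by (intro dvd_imp_multiplicity_le)
    then show "\<forall>p\<in>prime_factors d. multiplicity p d \<le> exponent p \<omega>"
      using mult by (metis in_prime_factors_imp_prime)
  next
    assume *: "\<forall>p\<in>prime_factors d. multiplicity p d \<le> exponent p \<omega>"
    show "d dvd limit_gcd \<omega>"
    proof (rule multiplicity_le_imp_dvd)
      fix p :: nat assume p: "prime p"
      show "multiplicity p d \<le> multiplicity p (limit_gcd \<omega>)"
      proof (cases "p \<in> prime_factors d")
        case True
        then show ?thesis using * mult[OF p] by simp
      next
        case False
        then have "multiplicity p d = 0"
          using p d by (auto simp: prime_factors_multiplicity)
        then show ?thesis by simp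
      qed
    qed (use d in auto)
  qed
qed

text \<open>Almost surely, divisibility by \<open>d\<close> says that the exponents dominate the
  multiplicities of \<open>d\<close>. The resulting product of prime powers reassembles
  \<open>d\<close>.\<close>

lemma prob_dvd_limit_gcd:
  assumes d: "d > 0"
  shows "prob {\<omega> \<in> space M. d dvd limit_gcd \<omega>} = 1 / real d ^ r"
proof -
  have "prob {\<omega> \<in> space M. d dvd limit_gcd \<omega>} =
      prob {\<omega> \<in> space M. \<forall>p\<in>prime_factors d. multiplicity p d \<le> exponent p \<omega>}"
  proof (rule finite_measure_eq_AE)
    show "AE \<omega> in M. \<omega> \<in> {\<omega> \<in> space M. d dvd limit_gcd \<omega>} \<longleftrightarrow>
        \<omega> \<in> {\<omega> \<in> space M. \<forall>p\<in>prime_factors d. multiplicity p d \<le> exponent p \<omega>}"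
      using AE_finite_exponents by eventually_elim (auto simp: dvd_limit_gcd_iff d)
    show "{\<omega> \<in> space M. \<forall>p\<in>prime_factors d. multiplicity p d \<le> exponent p \<omega>} \<in> events"
    proof (rule sets.sets_Collect_finite_All)
      fix p assume "p \<in> prime_factors d"
      then have [measurable]: "exponent p \<in> measurable M (count_space UNIV)"
        by (intro measurable_exponent) auto
      show "{\<omega> \<in> space M. multiplicity p d \<le> exponent p \<omega>} \<in> events" by measurable
    qed simp
  qed simp
  also have "\<dots> = (\<Prod>p\<in>prime_factors d. (1 / real p) ^ multiplicity p d) ^ r"
    by (rule prob_exponents_ge) auto
  also have "(\<Prod>p\<in>prime_factors d. (1 / real p) ^ multiplicity p d) =
      1 / real (\<Prod>p\<in>prime_factors d. p ^ multiplicity p d)"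
    by (simp add: power_divide prod_dividef)
  also have "(\<Prod>p\<in>prime_factors d. p ^ multiplicity p d) = d"
    using d by (simp add: prod_prime_factors)
  finally show ?thesis by (simp add: power_divide)
qed

end

section \<open>Uniform law on the region and conclusion\<close>

text \<open>The density vanishes outside the finite set \<open>H\<close>, so its integral is a
  finite sum of equal weights. This turns probabilities into proportions of lattice points.\<close>

lemma (in prob_space) prob_uniform_on_finite:
  fixes Z :: "'a \<Rightarrow> 'c"
  assumes D: "distributed M (count_space \<Omega>) Z (\<lambda>x. ennreal (indicator H x / real (card H)))"
    and H: "finite H" "H \<subseteq> \<Omega>"
  shows "prob {\<omega> \<in> space M. P (Z \<omega>)} = real (card {x \<in> H. P x}) / real (card H)"
proof -
  have Z: "Z \<in> measurable M (count_space \<Omega>)" using D by (rule distributed_measurable)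
  have "emeasure M {\<omega> \<in> space M. P (Z \<omega>)} = emeasure (distr M (count_space \<Omega>) Z) {x \<in> \<Omega>. P x}"
    using measurable_space[OF Z]
    by (subst emeasure_distr[OF Z]) (auto intro!: arg_cong[where f = "emeasure M"])
  also have "\<dots> = (\<integral>\<^sup>+x. ennreal (indicator H x / real (card H)) * indicator {x \<in> \<Omega>. P x} x \<partial>count_space \<Omega>)"
    by (simp add: distributed_distr_eq_density[OF D] emeasure_density)
  also have "\<dots> = (\<Sum>x\<in>{x \<in> H. P x}. ennreal (indicator H x / real (card H)) * indicator {x \<in> \<Omega>. P x} x)"
    using H by (intro nn_integral_count_space') (auto simp: indicator_def)
  also have "\<dots> = (\<Sum>x\<in>{x \<in> H. P x}. ennreal (1 / real (card H)))"
    using H by (intro sum.cong) (auto simp: indicator_def)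
  also have "\<dots> = ennreal (real (card {x \<in> H. P x}) / real (card H))"
    by (subst sum_ennreal) auto
  finally show ?thesis by (simp add: measure_def)
qed

theorem theorem3p5:
  fixes r l :: nat
    and N :: "nat \<Rightarrow> 'a measure"
    and V :: "nat \<Rightarrow> nat \<Rightarrow> 'a \<Rightarrow> nat"
    and M :: "'b measure"
    and G :: "nat \<Rightarrow> nat \<Rightarrow> 'b \<Rightarrow> nat"
    and f :: "nat \<Rightarrow> complex"
  assumes "r \<ge> 2" and "1 \<le> l" and "l \<le> r"
    and "\<And>n. n \<ge> r choose l \<Longrightarrow> prob_space (N n)"
    and "\<And>n. n \<ge> r choose l \<Longrightarrow>
           distributed (N n) (count_space ({1..r} \<rightarrow>\<^sub>E UNIV)) (\<lambda>\<omega>. \<lambda>k\<in>{1..r}. V n k \<omega>)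
             (\<lambda>x. ennreal (indicator (hyperbolic_region l r n) x
                            / real (card (hyperbolic_region l r n))))"
    and "prob_space M"
    and "prob_space.indep_vars M (\<lambda>_. count_space UNIV) (\<lambda>(k, p). G k p) ({1..} \<times> {p. prime p})"
    and "\<And>k p j. k \<ge> 1 \<Longrightarrow> prime p \<Longrightarrow>
           measure M {\<omega> \<in> space M. G k p \<omega> = j} = (1 - 1 / real p) * (1 / real p) ^ j"
  shows "converges_in_distribution
           N (\<lambda>n \<omega>. f (GCD k\<in>{1..r}. V n k \<omega>))
           M (\<lambda>\<omega>. f (\<Prod>p. if prime p then p ^ (MIN k\<in>{1..r}. G k p \<omega>) else 1))"
proof -
  interpret geometric_exponents M G r
    using assms by (intro geometric_exponents.intro geometric_exponents_axioms.intro) auto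
  let ?H = "hyperbolic_region l r"
  define X where "X n \<omega> = (GCD k\<in>{1..r}. V n k \<omega>)" for n \<omega>
  note l = assms(2,3)
  have H: "finite (?H n)" "?H n \<subseteq> {1..r} \<rightarrow>\<^sub>E UNIV" for n
    by (rule finite_hyperbolic_region[OF l]) (auto simp: hyperbolic_region_def)
  have measX: "X n \<in> measurable (N n) (count_space UNIV)" if n: "n \<ge> r choose l" for n
  proof -
    \<comment> \<open>\<open>distributed\<close> includes measurability of the restricted tuple into
      a discrete space, and the gcd reads only the indices in \<open>{1..r}\<close>.\<close>
    have "(\<lambda>\<omega>. GCD k\<in>{1..r}. (\<lambda>k\<in>{1..r}. V n k \<omega>) k) \<in> measurable (N n) (count_space UNIV)"
      by (rule measurable_compose[OF distributed_measurable[OF assms(5)[OF n]]]) simp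
    also have "(\<lambda>\<omega>. GCD k\<in>{1..r}. (\<lambda>k\<in>{1..r}. V n k \<omega>) k) = X n"
      by (auto simp: X_def intro!: arg_cong[where f = Gcd])
    finally show ?thesis .
  qed
  have prob_dvd: "measure (N n) {\<omega> \<in> space (N n). d dvd X n \<omega>} =
      real (card {x \<in> ?H n. \<forall>k\<in>{1..r}. d dvd x k}) / real (card (?H n))"
    if n: "n \<ge> r choose l" for n d
  proof -
    interpret N: prob_space "N n" using assms(4)[OF n] .
    have "d dvd X n \<omega> \<longleftrightarrow> (\<forall>k\<in>{1..r}. d dvd (\<lambda>k\<in>{1..r}. V n k \<omega>) k)" for \<omega>
      by (auto simp: X_def dvd_Gcd_iff)
    then show ?thesis
      using N.prob_uniform_on_finite[OF assms(5)[OF n] H, of "\<lambda>x. \<forall>k\<in>{1..r}. d dvd x k"] by simp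
  qed
  have bound: "measure (N n) {\<omega> \<in> space (N n). d dvd X n \<omega>} \<le> 1 / real d ^ r"
    if n: "n \<ge> r choose l" and d: "d > 0" for n d
  proof -
    have "real d ^ r * real (card {x \<in> ?H n. \<forall>k\<in>{1..r}. d dvd x k}) \<le> real (card (?H n))"
      using card_multiples_le[OF l, of d n, THEN of_nat_mono[where 'a = real]] d by simp
    \<comment> \<open>The case of cardinality 0 is settled by \<open>x / 0 = 0\<close>.\<close>
    then show ?thesis
      using d unfolding prob_dvd[OF n] by (cases "card (?H n) = 0") (auto simp: field_simps)
  qed
  have lim: "(\<lambda>n. measure (N n) {\<omega> \<in> space (N n). d dvd X n \<omega>})
      \<longlonglongrightarrow> measure M {\<omega> \<in> space M. d dvd limit_gcd \<omega>}" if d: "d > 0" for d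
    unfolding prob_dvd_limit_gcd[OF d]
  proof (rule Lim_transform_eventually)
    show "(\<lambda>n. real (card {x \<in> ?H n. \<forall>k\<in>{1..r}. d dvd x k}) / real (card (?H n))) \<longlonglongrightarrow> 1 / real d ^ r"
      using d by (intro density_of_multiples[OF l]) simp
    show "\<forall>\<^sub>F n in sequentially. real (card {x \<in> ?H n. \<forall>k\<in>{1..r}. d dvd x k}) / real (card (?H n)) =
        measure (N n) {\<omega> \<in> space (N n). d dvd X n \<omega>}"
      by (rule eventually_sequentiallyI[of "r choose l"]) (simp add: prob_dvd)
  qed
  have summable: "summable (\<lambda>d. 1 / real d ^ r)"
    using inverse_power_summable[OF r, where 'a = real] by (simp add: field_simps)
  \<comment> \<open>The composite of \<open>g\<close> and \<open>f\<close> is a bounded function on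
    the naturals, so the divisibility criterion applies to arbitrary \<open>f\<close>.\<close>
  have expectation: "(\<lambda>n. \<integral>\<omega>. g (f (X n \<omega>)) \<partial>N n) \<longlonglongrightarrow> (\<integral>\<omega>. g (f (limit_gcd \<omega>)) \<partial>M)"
    if "bounded (range g)" for g :: "complex \<Rightarrow> real"
  proof -
    obtain b where b: "\<And>z. \<bar>g z\<bar> \<le> b"
      using \<open>bounded (range g)\<close> by (auto simp: bounded_iff)
    show ?thesis
    proof (rule tendsto_expectation_of_tendsto_dvd[where h = "\<lambda>m. g (f m)"])
      show "\<forall>\<^sub>F n in sequentially. prob_space (N n) \<and> X n \<in> measurable (N n) (count_space UNIV)"
        by (rule eventually_sequentiallyI[of "r choose l"]) (simp add: assms(4) measX)
      show "\<forall>\<^sub>F n in sequentially. \<forall>d>0. measure (N n) {\<omega> \<in> space (N n). d dvd X n \<omega>} \<le> 1 / real d ^ r"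
        by (rule eventually_sequentiallyI[of "r choose l"]) (simp add: bound)
    qed (use lim summable b assms(6) in auto)
  qed
  have "\<forall>\<^sub>F n in sequentially. (\<lambda>\<omega>. f (X n \<omega>)) \<in> borel_measurable (N n)"
    by (rule eventually_sequentiallyI[of "r choose l"]) (rule measurable_compose[OF measX], auto)
  moreover have "(\<lambda>\<omega>. f (limit_gcd \<omega>)) \<in> borel_measurable M"
    by (rule measurable_compose[OF measurable_limit_gcd]) simp
  ultimately have "converges_in_distribution N (\<lambda>n \<omega>. f (X n \<omega>)) M (\<lambda>\<omega>. f (limit_gcd \<omega>))"
    unfolding converges_in_distribution_def using expectation by blast
  then show ?thesis
    by (simp only: X_def limit_gcd_def exponent_def)
qed

end
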